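(* Let $P$ be a data distribution on $\mathcal Z$ and suppose that for every $z\in\mathcal Z$ the function $l(\cdot;z)$ is $\alpha$-strongly convex, $\beta$-smooth and $L$-Lipschitz on $\Omega$, where $0<\alpha\le\beta$; put $\kappa=\beta/\alpha$. Consider gradient descent with constant step-size $0<\eta\le\frac1\beta$ on the empirical risk $R_S$ with sample size $n$, whose output at iteration $T\ge1$ is $\hat\theta_T$. Then its uniform stability satisfies $$\mathcal E_{\mathrm{stab}}^{\mathrm{GD,\,strongly\ convex}}(\hat\theta_T,l,P,n)\le\frac{4L^2}{\alpha n}\left(1-\left(1-\frac{\eta\beta}{1+\kappa}\right)^T\right).$$
   Context: $\Omega\subset\mathbb R^d$ is a convex parameter set, $l(\theta;z)$ a loss for $\theta\in\Omega$, $z\in\mathcal Z$; for a sample $S=(z_1,\dots,z_n)$ drawn i.i.d. from $P$, $R_S(\theta)=\frac1n\sum_{j=1}^n l(\theta;z_j)$. Gradient descent on an objective $F$ starts at $\theta_0\in\Omega$ (the same for all samples) and iterates $\theta_{t+1}=\theta_t-\eta\nabla F(\theta_t)$, $t\ge0$; here $F=R_S$ and $\hat\theta_T=\theta_T$. The iterates are assumed to remain in $\Omega$. Uniform stability: an algorithm with output $\hat\theta_S$ on sample $S$ is $\epsilon$-uniformly stable if for all $k\in\{1,\dots,n\}$ and all pairs of samples $S=(z_1,\dots,z_k,\dots,z_n)$, $S'=(z_1,\dots,z_k',\dots,z_n)$ with entries drawn i.i.d. from $P$, $\sup_{z\in\mathcal Z}|l(\hat\theta_S;z)-l(\hat\theta_{S'};z)|\le\epsilon$;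 $\mathcal E_{\mathrm{stab}}(\hat\theta,l,P,n)$ is the smallest such $\epsilon$. $f$ is $L$-Lipschitz if $|f(u)-f(v)|\le L\|u-v\|_2$, (continuously differentiable and) $\beta$-smooth if $\|\nabla f(u)-\nabla f(v)\|_2\le\beta\|u-v\|_2$, and $\alpha$-strongly convex if $f(u)\ge f(v)+\langle\nabla f(v),u-v\rangle+\frac\alpha2\|u-v\|_2^2$, for all $u,v\in\Omega$. *)

theory Defs
  imports "HOL-Probability.Probability"
begin

text \<open>
  The derivative is taken within \<open>\<Omega>\<close>, so \<open>f\<close> matters only on \<open>\<Omega>\<close>. If \<open>\<Omega>\<close> is convex with nonempty
  interior, \<open>g\<close> is determined on \<open>\<Omega>\<close>; if \<open>\<Omega>\<close> lies in a proper affine subspace it is not, and hence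
  gradients are passed as explicit arguments below. The gradient of a function that is
  differentiable in the ambient space at every point of \<open>\<Omega>\<close> always qualifies.
\<close>
definition gradient_on ::
    "'a::euclidean_space set \<Rightarrow> ('a \<Rightarrow> real) \<Rightarrow> ('a \<Rightarrow> 'a) \<Rightarrow> bool" where
  "gradient_on \<Omega> f g \<longleftrightarrow> (\<forall>u\<in>\<Omega>. (f has_derivative (\<lambda>h. g u \<bullet> h)) (at u within \<Omega>))"

definition smooth_on ::
    "real \<Rightarrow> 'a::euclidean_space set \<Rightarrow> ('a \<Rightarrow> real) \<Rightarrow> ('a \<Rightarrow> 'a) \<Rightarrow> bool" where
  "smooth_on \<beta> \<Omega> f g \<longleftrightarrow> gradient_on \<Omega> f g \<and> \<beta>-lipschitz_on \<Omega> g"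

definition strongly_convex_on ::
    "real \<Rightarrow> 'a::euclidean_space set \<Rightarrow> ('a \<Rightarrow> real) \<Rightarrow> ('a \<Rightarrow> 'a) \<Rightarrow> bool" where
  "strongly_convex_on \<alpha> \<Omega> f g \<longleftrightarrow> gradient_on \<Omega> f g \<and>
     (\<forall>u\<in>\<Omega>. \<forall>v\<in>\<Omega>. f u \<ge> f v + g v \<bullet> (u - v) + \<alpha> / 2 * (norm (u - v))\<^sup>2)"

text \<open>Samples are indexed by \<open>0, \<dots>, n - 1\<close>.\<close>

definition samples :: "'z measure \<Rightarrow> nat \<Rightarrow> (nat \<Rightarrow> 'z) set" where
  "samples P n = space (Pi\<^sub>M {..<n} (\<lambda>_. P))"

definition emp_risk ::
    "('a \<Rightarrow> 'z \<Rightarrow> real) \<Rightarrow> nat \<Rightarrow> (nat \<Rightarrow> 'z) \<Rightarrow> 'a \<Rightarrow> real" where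
  "emp_risk l n S \<theta> = (\<Sum>j<n. l \<theta> (S j)) / real n"

text \<open>The argument \<open>g\<close> is the gradient of the objective.\<close>

primrec gd ::
    "('a::real_vector \<Rightarrow> 'a) \<Rightarrow> real \<Rightarrow> 'a \<Rightarrow> nat \<Rightarrow> 'a" where
  "gd g \<eta> \<theta>\<^sub>0 0 = \<theta>\<^sub>0"
| "gd g \<eta> \<theta>\<^sub>0 (Suc t) = gd g \<eta> \<theta>\<^sub>0 t - \<eta> *\<^sub>R g (gd g \<eta> \<theta>\<^sub>0 t)"

text \<open>
  An algorithm \<open>A\<close> maps a sample to its output. The data domain is \<open>space P\<close>, and the condition is
  imposed on every pair of neighbouring samples in the product space, without exceptional null
  sets. Values are extended reals because the supremum over \<open>z\<close> may be infinite.
\<close>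
definition uniformly_stable ::
    "((nat \<Rightarrow> 'z) \<Rightarrow> 'a) \<Rightarrow> ('a \<Rightarrow> 'z \<Rightarrow> real) \<Rightarrow> 'z measure \<Rightarrow> nat \<Rightarrow> ereal \<Rightarrow> bool" where
  "uniformly_stable A l P n \<epsilon> \<longleftrightarrow>
     (\<forall>k<n. \<forall>S\<in>samples P n. \<forall>S'\<in>samples P n. (\<forall>j<n. j \<noteq> k \<longrightarrow> S j = S' j) \<longrightarrow>
        (SUP z\<in>space P. ereal \<bar>l (A S) z - l (A S') z\<bar>) \<le> \<epsilon>)"

definition unif_stab ::
    "((nat \<Rightarrow> 'z) \<Rightarrow> 'a) \<Rightarrow> ('a \<Rightarrow> 'z \<Rightarrow> real) \<Rightarrow> 'z measure \<Rightarrow> nat \<Rightarrow> ereal" where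
  "unif_stab A l P n = Inf {\<epsilon>. uniformly_stable A l P n \<epsilon>}"

text \<open>The infimum is a minimum.\<close>

lemma uniformly_stable_unif_stab: "uniformly_stable A l P n (unif_stab A l P n)"
proof -
  have "(SUP z\<in>space P. ereal \<bar>l (A S) z - l (A S') z\<bar>) \<le> unif_stab A l P n"
    if "k < n" "S \<in> samples P n" "S' \<in> samples P n" "\<forall>j<n. j \<noteq> k \<longrightarrow> S j = S' j" for k S S'
    unfolding unif_stab_def
  proof (rule Inf_greatest)
    fix \<epsilon> assume "\<epsilon> \<in> {\<epsilon>. uniformly_stable A l P n \<epsilon>}"
    with that show "(SUP z\<in>space P. ereal \<bar>l (A S) z - l (A S') z\<bar>) \<le> \<epsilon>"
      unfolding uniformly_stable_def by blast
  qed
  then show ?thesis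
    unfolding uniformly_stable_def by blast
qed

end

theory Submission
  imports Defs
begin

text \<open>
  The map \<open>q x = x - \<eta> *\<^sub>R \<nabla>R x\<close> is the gradient of \<open>h x = (norm x)\<^sup>2 / 2 - \<eta> * R x\<close>. Smoothness and
  strong convexity of \<open>R\<close> put the Bregman divergence of \<open>h\<close> between \<open>0\<close> and \<open>(1 - \<eta> * \<alpha>) / 2\<close> times the
  squared distance, so a gradient step contracts by the factor \<open>1 - \<eta> * \<alpha>\<close>. As \<open>\<Omega>\<close> need not be the
  whole space, this contraction is first obtained for pairs of close points with some room around
  them, then along segments shrunk towards an interior point, and finally in the limit.
  Exchanging one sample point moves a step by at most \<open>2 * L * \<eta> / n\<close>, and summing the geometric
  series with \<open>\<eta> * \<beta> / (1 + \<kappa>) \<le> \<eta> * \<alpha> \<le> 2 * \<eta> * \<beta> / (1 + \<kappa>)\<close> gives the bound.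

  If \<open>\<Omega>\<close> is not full-dimensional, gradients are determined only along differences of points
  of \<open>\<Omega>\<close>. All estimates are therefore tested against a vector \<open>u' - v'\<close> with \<open>u', v' \<in> \<Omega>\<close>, which
  suffices because the iterates stay in \<open>\<Omega>\<close>.
\<close>

section \<open>Gradients relative to a convex set, along segments\<close>

lemma convex_segment_mem:
  fixes \<Omega> :: "'a::real_vector set"
  assumes "convex \<Omega>" "x \<in> \<Omega>" "y \<in> \<Omega>" "0 \<le> t" "t \<le> 1"
  shows "x + t *\<^sub>R (y - x) \<in> \<Omega>"
  using convexD_alt[OF assms] by (simp add: algebra_simps)

lemma gradient_on_segment:
  fixes f :: "'a::euclidean_space \<Rightarrow> real"
  assumes "gradient_on \<Omega> f g" "convex \<Omega>" "x \<in> \<Omega>" "y \<in> \<Omega>" "t \<in> {0..1}"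
  shows "((\<lambda>t. f (x + t *\<^sub>R (y - x))) has_real_derivative
           g (x + t *\<^sub>R (y - x)) \<bullet> (y - x)) (at t within {0..1})"
proof -
  have mem: "x + s *\<^sub>R (y - x) \<in> \<Omega>" if "s \<in> {0..1}" for s
    using convex_segment_mem assms(2-4) that by auto
  have "(f has_derivative (\<lambda>h. g (x + t *\<^sub>R (y - x)) \<bullet> h)) (at (x + t *\<^sub>R (y - x)) within \<Omega>)"
    using assms(1) mem[OF assms(5)] by (auto simp: gradient_on_def)
  then have "(f has_derivative (\<lambda>h. g (x + t *\<^sub>R (y - x)) \<bullet> h))
      (at (x + t *\<^sub>R (y - x)) within (\<lambda>s. x + s *\<^sub>R (y - x)) ` {0..1})"
    by (rule has_derivative_subset) (use mem in auto)
  moreover have "((\<lambda>s. x + s *\<^sub>R (y - x)) has_derivative (\<lambda>h. h *\<^sub>R (y - x))) (at t within {0..1})"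
    by (auto intro!: derivative_eq_intros)
  ultimately have "((\<lambda>s. f (x + s *\<^sub>R (y - x))) has_derivative
      (\<lambda>h. g (x + t *\<^sub>R (y - x)) \<bullet> (h *\<^sub>R (y - x)))) (at t within {0..1})"
    by (rule has_derivative_in_compose[rotated])
  then show ?thesis
    by (simp add: has_field_derivative_def mult.commute[of _ "g _ \<bullet> _"])
qed

text \<open>A one-sided derivative at an endpoint of a segment is still unique, which fixes the
  pairing with \<open>y - x\<close> and with \<open>z - x\<close>; subtracting the two gives
  \<open>y - z\<close>. This allows a prescribed gradient of the empirical risk to be exchanged for
  the average of the loss gradients.\<close>

lemma gradient_on_inner_unique:
  fixes f :: "'a::euclidean_space \<Rightarrow> real"
  assumes "gradient_on \<Omega> f g" "gradient_on \<Omega> f g'" "convex \<Omega>" "x \<in> \<Omega>" "y \<in> \<Omega>" "z \<in> \<Omega>"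
  shows "g x \<bullet> (y - z) = g' x \<bullet> (y - z)"
proof -
  have *: "g x \<bullet> (y - x) = g' x \<bullet> (y - x)" if "y \<in> \<Omega>" for y
  proof -
    have "((\<lambda>t. f (x + t *\<^sub>R (y - x))) has_vector_derivative g x \<bullet> (y - x)) (at 0 within {0..1})"
      "((\<lambda>t. f (x + t *\<^sub>R (y - x))) has_vector_derivative g' x \<bullet> (y - x)) (at 0 within {0..1})"
      using gradient_on_segment[OF assms(1,3,4) that, of 0]
        gradient_on_segment[OF assms(2,3,4) that, of 0]
      by (simp_all add: has_real_derivative_iff_has_vector_derivative)
    then show ?thesis
      by (intro vector_derivative_unique_within_closed_interval[of 0 1 0]) auto
  qed
  show ?thesis
    using *[OF assms(5)] *[OF assms(6)] by (simp add: inner_diff_right)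
qed

text \<open>Along the segment, the gap \<phi> between \<open>f\<close> and its quadratic model has
  derivative at most 0, by Cauchy-Schwarz and the Lipschitz gradient.\<close>

lemma smooth_on_quadratic_upper:
  fixes f :: "'a::euclidean_space \<Rightarrow> real"
  assumes "smooth_on \<beta> \<Omega> f g" "convex \<Omega>" "x \<in> \<Omega>" "y \<in> \<Omega>"
  shows "f y \<le> f x + g x \<bullet> (y - x) + \<beta> / 2 * (norm (y - x))\<^sup>2"
proof -
  define p where "p t = x + t *\<^sub>R (y - x)" for t
  define \<phi> where "\<phi> t = f (p t) - t * (g x \<bullet> (y - x)) - \<beta> / 2 * t\<^sup>2 * (norm (y - x))\<^sup>2" for t
  have grad: "gradient_on \<Omega> f g" and lip: "\<beta>-lipschitz_on \<Omega> g"
    using assms(1) by (auto simp: smooth_on_def)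
  have mem: "p t \<in> \<Omega>" if "t \<in> {0..1}" for t
    using convex_segment_mem assms(2-4) that by (auto simp: p_def)
  have der: "(\<phi> has_real_derivative
      g (p t) \<bullet> (y - x) - g x \<bullet> (y - x) - \<beta> * t * (norm (y - x))\<^sup>2) (at t within {0..1})"
    if "t \<in> {0..1}" for t
    using gradient_on_segment[OF grad assms(2-4) that]
    unfolding \<phi>_def p_def
    by (auto intro!: derivative_eq_intros)
  have "\<phi> 1 \<le> \<phi> 0"
  proof (rule DERIV_nonpos_imp_decreasing_open[where f = \<phi> and a = 0 and b = 1])
    fix t :: real assume t: "0 < t" "t < 1"
    have "(g (p t) - g x) \<bullet> (y - x) \<le> norm (g (p t) - g x) * norm (y - x)"
      by (rule norm_cauchy_schwarz)
    also have "\<dots> \<le> (\<beta> * norm (p t - x)) * norm (y - x)"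
      using lipschitz_onD[OF lip mem[of t] assms(3)] t
      by (intro mult_right_mono) (auto simp: dist_norm)
    also have "\<dots> = \<beta> * t * (norm (y - x))\<^sup>2"
      using t by (simp add: p_def power2_eq_square)
    finally show "\<exists>d. (\<phi> has_real_derivative d) (at t) \<and> d \<le> 0"
      using der[of t] t at_within_Icc_at[of 0 t 1]
      by (auto simp: inner_diff_left)
  next
    show "continuous_on {0..1} \<phi>"
      using der by (rule DERIV_continuous_on)
  qed simp
  then show ?thesis by (simp add: \<phi>_def p_def)
qed

section \<open>From two-sided Bregman bounds to a Lipschitz bound\<close>

text \<open>
  The mean of \<open>u, v, u', v'\<close> is interior to \<open>\<Omega>\<close> in the two directions \<open>u - v\<close> and \<open>u' - v'\<close>, and any
  point pulled towards it by \<open>\<delta>\<close> has room proportional to \<open>\<delta>\<close>.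
\<close>
lemma convex_shift_mem:
  fixes \<Omega> :: "'a::real_vector set"
  assumes "convex \<Omega>" "x \<in> \<Omega>" "u \<in> \<Omega>" "v \<in> \<Omega>" "u' \<in> \<Omega>" "v' \<in> \<Omega>"
    and "0 < \<delta>" "\<delta> \<le> 1" "\<bar>s\<bar> \<le> \<delta> / 4" "\<bar>t\<bar> \<le> \<delta> / 4"
  shows "(1 - \<delta>) *\<^sub>R x + (\<delta> / 4) *\<^sub>R (u + v + u' + v') + s *\<^sub>R (u - v) + t *\<^sub>R (u' - v') \<in> \<Omega>"
proof -
  \<comment> \<open>Each of \<open>?p\<close> and \<open>?q\<close> below enters with total weight
    \<open>\<delta> / 2\<close>, so tilting its weights by \<open>2 * r / \<delta>\<close> shifts
    the result by exactly \<open>r\<close> times the difference; \<bar>r\<bar> \<le> \<delta> / 4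
    keeps the weights nonnegative.\<close>
  have *: "(1/2 + 2 * r / \<delta>) *\<^sub>R a + (1/2 - 2 * r / \<delta>) *\<^sub>R b \<in> \<Omega>"
    if "a \<in> \<Omega>" "b \<in> \<Omega>" "\<bar>r\<bar> \<le> \<delta> / 4" for a b r
  proof -
    have "\<bar>2 * r / \<delta>\<bar> \<le> 1/2"
      using assms(7) that(3) by (simp add: field_simps abs_mult)
    then have "0 \<le> 1/2 + 2 * r / \<delta>" "0 \<le> 1/2 - 2 * r / \<delta>" by linarith+
    then show ?thesis
      using that(1,2) by (intro convexD[OF assms(1)]) auto
  qed
  let ?p = "(1/2 + 2 * s / \<delta>) *\<^sub>R u + (1/2 - 2 * s / \<delta>) *\<^sub>R v"
  let ?q = "(1/2 + 2 * t / \<delta>) *\<^sub>R u' + (1/2 - 2 * t / \<delta>) *\<^sub>R v'"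
  have "(1/2) *\<^sub>R ?p + (1/2) *\<^sub>R ?q \<in> \<Omega>"
    by (rule convexD[OF assms(1) *[OF assms(3,4,9)] *[OF assms(5,6,10)]]) auto
  then have "(1 - \<delta>) *\<^sub>R x + \<delta> *\<^sub>R ((1/2) *\<^sub>R ?p + (1/2) *\<^sub>R ?q) \<in> \<Omega>"
    using assms(7,8) by (intro convexD[OF assms(1,2)]) auto
  also have "(1 - \<delta>) *\<^sub>R x + \<delta> *\<^sub>R ((1/2) *\<^sub>R ?p + (1/2) *\<^sub>R ?q) =
     (1 - \<delta>) *\<^sub>R x + (\<delta> / 4) *\<^sub>R (u + v + u' + v') + s *\<^sub>R (u - v) + t *\<^sub>R (u' - v')"
    using assms(7)
    by (simp add: scaleR_add_right scaleR_diff_right scaleR_add_left scaleR_diff_left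
        distrib_left right_diff_distrib)
  finally show ?thesis .
qed

text \<open>
  With \<open>a = (e + (x - y)) / 2\<close>, the divergences from \<open>x\<close> and \<open>y\<close> to \<open>x - a\<close> and \<open>y + a\<close> combine so that
  all values of \<open>h\<close> cancel and \<open>(q x - q y) \<bullet> e\<close> remains.
\<close>
lemma bregman_four_point:
  fixes q :: "'a::real_inner \<Rightarrow> 'a" and h :: "'a \<Rightarrow> real"
  assumes lower: "\<And>x y. x \<in> \<Omega> \<Longrightarrow> y \<in> \<Omega> \<Longrightarrow> 0 \<le> h x - h y - q y \<bullet> (x - y)"
    and upper: "\<And>x y. x \<in> \<Omega> \<Longrightarrow> y \<in> \<Omega> \<Longrightarrow> h x - h y - q y \<bullet> (x - y) \<le> m / 2 * (norm (x - y))\<^sup>2"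
    and "0 \<le> m" "norm e = norm (x - y)"
    and "x \<in> \<Omega>" "y \<in> \<Omega>" "x - (1/2) *\<^sub>R (e + (x - y)) \<in> \<Omega>" "y + (1/2) *\<^sub>R (e + (x - y)) \<in> \<Omega>"
  shows "(q x - q y) \<bullet> e \<le> m * (norm (x - y))\<^sup>2"
proof -
  define a where "a = (1/2) *\<^sub>R (e + (x - y))"
  have e: "e = a + a - (x - y)"
    by (simp add: a_def flip: scaleR_2)
  have mem: "x - a \<in> \<Omega>" "y + a \<in> \<Omega>"
    using assms(7,8) by (auto simp: a_def)
  have "norm a \<le> norm (x - y)"
    using norm_triangle_ineq[of e "x - y"] assms(4) by (simp add: a_def)
  then have "(norm a)\<^sup>2 \<le> (norm (x - y))\<^sup>2"
    by (intro power_mono) auto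
  then have "m * (norm a)\<^sup>2 \<le> m * (norm (x - y))\<^sup>2"
    using assms(3) by (intro mult_left_mono) auto
  \<comment> \<open>The upper bounds compare \<open>x - a\<close> with \<open>x\<close> and
    \<open>y + a\<close> with \<open>y\<close>, each costing
    \<open>m / 2 * (norm a)\<^sup>2\<close>; the lower bounds compare the same points crosswise,
    \<open>y + a\<close> with \<open>x\<close> and \<open>x - a\<close> with
    \<open>y\<close>.\<close>
  moreover have "(q x - q y) \<bullet> e \<le> m * (norm a)\<^sup>2"
    using upper[OF mem(1) assms(5)] upper[OF mem(2) assms(6)]
      lower[OF mem(2) assms(5)] lower[OF mem(1) assms(6)]
    unfolding e by (simp add: inner_diff_left inner_diff_right inner_add_right)
  ultimately show ?thesis by linarith
qed

text \<open>The four-point bound needs auxiliary points inside \<Omega>, so it is applied only to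
  short pieces of the segment pulled inward by \<delta>, with the test vector rescaled to the length
  of a piece. Summing telescopes the left side, and the rescaling turns the squared lengths into the
  product of the two norms. Continuity of \<open>q\<close> removes \<delta>.\<close>

lemma bregman_bounds_imp_inner_lipschitz:
  fixes q :: "'a::real_inner \<Rightarrow> 'a" and h :: "'a \<Rightarrow> real"
  assumes lower: "\<And>x y. x \<in> \<Omega> \<Longrightarrow> y \<in> \<Omega> \<Longrightarrow> 0 \<le> h x - h y - q y \<bullet> (x - y)"
    and upper: "\<And>x y. x \<in> \<Omega> \<Longrightarrow> y \<in> \<Omega> \<Longrightarrow> h x - h y - q y \<bullet> (x - y) \<le> m / 2 * (norm (x - y))\<^sup>2"
    and "0 \<le> m" "convex \<Omega>" "continuous_on \<Omega> q"
    and "u \<in> \<Omega>" "v \<in> \<Omega>" "u' \<in> \<Omega>" "v' \<in> \<Omega>"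
  shows "(q u - q v) \<bullet> (u' - v') \<le> m * norm (u - v) * norm (u' - v')"
proof (cases "u = v \<or> u' = v'")
  case True
  then show ?thesis by auto
next
  case False
  define w where "w = u - v"
  define e where "e = u' - v'"
  \<comment> \<open>Scaling \<open>e\<close> by \<rho> gives it the length of \<open>w\<close>, as
    the four-point bound requires.\<close>
  define \<rho> where "\<rho> = norm w / norm e"
  have we: "norm w > 0" "norm e > 0" using False by (auto simp: w_def e_def)
  have l0: "\<rho> > 0" using we by (simp add: \<rho>_def)
  define pull where "pull \<delta> x = (1 - \<delta>) *\<^sub>R x + (\<delta> / 4) *\<^sub>R (u + v + u' + v')" for \<delta> x
  have pull_shift: "pull \<delta> x + s *\<^sub>R w + t *\<^sub>R e \<in> \<Omega>"
    if "x \<in> \<Omega>" "0 < \<delta>" "\<delta> \<le> 1" "\<bar>s\<bar> \<le> \<delta> / 4" "\<bar>t\<bar> \<le> \<delta> / 4" for \<delta> x s t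
    using convex_shift_mem[OF assms(4) that(1) assms(6-9) that(2-)]
    by (simp add: pull_def w_def e_def)
  have pull_mem: "pull \<delta> x \<in> \<Omega>" if "x \<in> \<Omega>" "0 \<le> \<delta>" "\<delta> \<le> 1" for \<delta> x
    using pull_shift[of x \<delta> 0 0] that by (cases "\<delta> = 0") (auto simp: pull_def)
  have inner_pull: "(q (pull \<delta> u) - q (pull \<delta> v)) \<bullet> e \<le> m * norm w * norm e"
    if \<delta>: "0 < \<delta>" "\<delta> < 1" for \<delta>
  proof -
    \<comment> \<open>Pulling shrinks \<open>w\<close> by 1 - \<delta>, so a piece is
      \<open>r *\<^sub>R w\<close>. The choice of \<open>N\<close> makes the shifts
      \<open>r / 2\<close> and \<open>r * \<rho> / 2\<close> at most \<delta> / 4, the available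
      room.\<close>
    obtain N :: nat where N: "real N > 2 * (1 + \<rho>) / \<delta>"
      using reals_Archimedean2 by blast
    have "2 * (1 + \<rho>) / \<delta> > 0" using l0 \<delta> by simp
    then have N0: "N > 0" using N by (cases N) auto
    define r where "r = (1 - \<delta>) / N"
    have r: "0 < r" using N0 \<delta> by (simp add: r_def)
    have "r * (1 + \<rho>) \<le> 1 / N * (1 + \<rho>)"
      using \<delta> N0 l0 unfolding r_def by (intro mult_right_mono divide_right_mono) auto
    also have "\<dots> \<le> \<delta> / 2"
      using N N0 \<delta> by (simp add: field_simps)
    finally have small: "r + r * \<rho> \<le> \<delta> / 2" by (simp add: algebra_simps)
    have r\<rho>: "0 < r * \<rho>" using r l0 by simp
    define x where "x i = pull \<delta> (v + (real i / N) *\<^sub>R w)" for i :: nat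
    have seg: "v + (real i / N) *\<^sub>R w \<in> \<Omega>" if "i \<le> N" for i
      using convex_segment_mem[OF assms(4,7,6), of "real i / N"] N0 that by (simp add: w_def)
    have step: "x (Suc i) - x i = r *\<^sub>R w" for i
      using N0 by (simp add: x_def pull_def r_def algebra_simps add_divide_distrib)
    have "(q (x (Suc i)) - q (x i)) \<bullet> ((r * \<rho>) *\<^sub>R e) \<le> m * (norm (r *\<^sub>R w))\<^sup>2" if "i < N" for i
    proof -
      have 1: "x (Suc i) - (1/2) *\<^sub>R ((r * \<rho>) *\<^sub>R e + r *\<^sub>R w) \<in> \<Omega>"
        using pull_shift[OF seg[of "Suc i"], of \<delta> "- r / 2" "- r * \<rho> / 2"] small r r\<rho> \<delta> that
        by (simp add: x_def algebra_simps)
      have 2: "x i + (1/2) *\<^sub>R ((r * \<rho>) *\<^sub>R e + r *\<^sub>R w) \<in> \<Omega>"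
        using pull_shift[OF seg[of i], of \<delta> "r / 2" "r * \<rho> / 2"] small r r\<rho> \<delta> that
        by (simp add: x_def algebra_simps)
      have x: "x (Suc i) \<in> \<Omega>" "x i \<in> \<Omega>"
        using seg[of "Suc i"] seg[of i] pull_mem \<delta> that by (auto simp: x_def simp del: of_nat_Suc)
      have ne: "norm ((r * \<rho>) *\<^sub>R e) = norm (r *\<^sub>R w)"
        using we l0 r by (simp add: \<rho>_def)
      show ?thesis
        using bregman_four_point[of \<Omega> h q m "(r * \<rho>) *\<^sub>R e" "x (Suc i)" "x i"]
          lower upper assms(3) ne x 1 2 unfolding step by blast
    qed
    then have "(\<Sum>i<N. (q (x (Suc i)) - q (x i)) \<bullet> ((r * \<rho>) *\<^sub>R e)) \<le> (\<Sum>i<N. m * (norm (r *\<^sub>R w))\<^sup>2)"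
      by (intro sum_mono) auto
    \<comment> \<open>Here \<open>N * r = 1 - \<delta>\<close>, and
      \<open>r * (norm w)\<^sup>2 = r * \<rho> * norm w * norm e\<close>; the common factor
      \<open>r * \<rho>\<close> cancels afterwards.\<close>
    also have "\<dots> = (r * \<rho>) * ((1 - \<delta>) * (m * norm w * norm e))"
      using N0 we r by (simp add: r_def \<rho>_def power2_eq_square)
    also have "(\<Sum>i<N. (q (x (Suc i)) - q (x i)) \<bullet> ((r * \<rho>) *\<^sub>R e)) = 
        (r * \<rho>) * ((q (x N) - q (x 0)) \<bullet> e)"
      by (simp add: sum_lessThan_telescope[of "\<lambda>i. q (x i)"] flip: inner_sum_left sum_distrib_left)
    finally have "(q (x N) - q (x 0)) \<bullet> e \<le> (1 - \<delta>) * (m * norm w * norm e)"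
      using r\<rho> by (simp only: mult_le_cancel_left_pos)
    also have "\<dots> \<le> 1 * (m * norm w * norm e)"
      using \<delta> assms(3) by (intro mult_right_mono) auto
    finally show ?thesis using N0 by (simp add: x_def w_def)
  qed
  have cont: "continuous_on {0..1} (\<lambda>\<delta>. q (pull \<delta> x))" if "x \<in> \<Omega>" for x
    by (rule continuous_on_compose2[OF assms(5)])
       (use pull_mem that in \<open>auto simp: pull_def intro!: continuous_intros\<close>)
  \<comment> \<open>\<open>pull 0\<close> is the identity, and 0 lies in the closure of the open
    interval on which the bound is known.\<close>
  have "(q (pull 0 u) - q (pull 0 v)) \<bullet> e \<le> m * norm w * norm e"
    by (rule continuous_le_on_closure[where S = "{0<..<1}" and f = "\<lambda>\<delta>. (q (pull \<delta> u) - q (pull \<delta> v)) \<bullet> e"])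
       (use inner_pull cont assms in \<open>auto intro!: continuous_intros\<close>)
  then show ?thesis by (simp add: pull_def w_def e_def)
qed

section \<open>Gradients of Lipschitz functions and a single gradient step\<close>

text \<open>Difference quotients bound the gradient only in directions leading from the base point
  into \<Omega>, and \<open>y - z\<close> need not be one at \<open>x\<close>. It becomes one once
  \<open>x\<close> is pulled towards the midpoint of \<open>y\<close> and \<open>z\<close>;
  continuity of \<open>g\<close> then leads back to \<open>x\<close>.\<close>

lemma lipschitz_on_gradient_inner_le:
  fixes f :: "'a::euclidean_space \<Rightarrow> real"
  assumes "L-lipschitz_on \<Omega> f" "gradient_on \<Omega> f g" "continuous_on \<Omega> g" "convex \<Omega>"
    and "x \<in> \<Omega>" "y \<in> \<Omega>" "z \<in> \<Omega>"
  shows "g x \<bullet> (y - z) \<le> L * norm (y - z)"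
proof -
  have *: "g a \<bullet> (b - a) \<le> L * norm (b - a)" if "a \<in> \<Omega>" "b \<in> \<Omega>" for a b
  proof -
    have mem: "a + t *\<^sub>R (b - a) \<in> \<Omega>" if "t \<in> {0..1}" for t
      using convex_segment_mem[OF assms(4) \<open>a \<in> \<Omega>\<close> \<open>b \<in> \<Omega>\<close>] that by auto
    have "((\<lambda>t. (f (a + t *\<^sub>R (b - a)) - f a) / t) \<longlongrightarrow> g a \<bullet> (b - a)) (at 0 within {0..1})"
      using gradient_on_segment[OF assms(2,4) that, of 0] by (simp add: has_field_derivative_iff)
    moreover have "eventually (\<lambda>t. (f (a + t *\<^sub>R (b - a)) - f a) / t \<le> L * norm (b - a))
        (at 0 within {0..1})"
      unfolding eventually_at_filter
    proof (intro always_eventually allI impI)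
      fix t :: real assume t: "t \<noteq> 0" "t \<in> {0..1}"
      have "f (a + t *\<^sub>R (b - a)) - f a \<le> L * norm (b - a) * t"
        using lipschitz_onD[OF assms(1) mem[OF t(2)] that(1)] t by (simp add: dist_norm mult_ac)
      then show "(f (a + t *\<^sub>R (b - a)) - f a) / t \<le> L * norm (b - a)"
        using t by (simp add: pos_divide_le_eq)
    qed
    ultimately show ?thesis
      by (rule tendsto_upperbound) (simp add: trivial_limit_within islimpt_Icc)
  qed
  define pull where "pull \<delta> = (1 - \<delta>) *\<^sub>R x + (\<delta> / 4) *\<^sub>R (y + z + y + z)" for \<delta>
  have pull_shift: "pull \<delta> + t *\<^sub>R (y - z) \<in> \<Omega>" if "0 < \<delta>" "\<delta> \<le> 1" "\<bar>t\<bar> \<le> \<delta> / 4" for \<delta> t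
    using convex_shift_mem[OF assms(4,5,6,7,6,7) that(1,2), of 0 t] that by (simp add: pull_def)
  have pull_mem: "pull \<delta> \<in> \<Omega>" if "0 \<le> \<delta>" "\<delta> \<le> 1" for \<delta>
    using pull_shift[of \<delta> 0] that assms(5) by (cases "\<delta> = 0") (auto simp: pull_def)
  have bound: "g (pull \<delta>) \<bullet> (y - z) \<le> L * norm (y - z)" if "0 < \<delta>" "\<delta> < 1" for \<delta>
  proof -
    have "g (pull \<delta>) \<bullet> ((\<delta> / 4) *\<^sub>R (y - z)) \<le> L * norm ((\<delta> / 4) *\<^sub>R (y - z))"
      using *[OF pull_mem pull_shift, of \<delta> \<delta> "\<delta> / 4"] that by simp
    then have "(\<delta> / 4) * (g (pull \<delta>) \<bullet> (y - z)) \<le> (\<delta> / 4) * (L * norm (y - z))"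
      using that by (simp only: inner_scaleR_right norm_scaleR) (simp add: mult_ac)
    then show ?thesis
      using that by simp
  qed
  have cont: "continuous_on {0..1} (\<lambda>\<delta>. g (pull \<delta>))"
    by (rule continuous_on_compose2[OF assms(3)])
       (use pull_mem in \<open>auto simp: pull_def intro!: continuous_intros\<close>)
  have "g (pull 0) \<bullet> (y - z) \<le> L * norm (y - z)"
    by (rule continuous_le_on_closure[where S = "{0<..<1}" and f = "\<lambda>\<delta>. g (pull \<delta>) \<bullet> (y - z)"])
       (use bound cont in \<open>auto intro!: continuous_intros\<close>)
  then show ?thesis by (simp add: pull_def)
qed

lemma strongly_convex_smooth_step:
  fixes f :: "'a::euclidean_space \<Rightarrow> real"
  assumes "strongly_convex_on \<alpha> \<Omega> f g" "smooth_on \<beta> \<Omega> f g" "convex \<Omega>"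
    and "0 \<le> \<eta>" "\<eta> * \<alpha> \<le> 1" "\<eta> * \<beta> \<le> 1"
    and "u \<in> \<Omega>" "v \<in> \<Omega>" "u' \<in> \<Omega>" "v' \<in> \<Omega>"
  shows "((u - \<eta> *\<^sub>R g u) - (v - \<eta> *\<^sub>R g v)) \<bullet> (u' - v')
           \<le> (1 - \<eta> * \<alpha>) * norm (u - v) * norm (u' - v')"
proof (rule bregman_bounds_imp_inner_lipschitz[OF _ _ _ assms(3) _ assms(7-10),
      where h = "\<lambda>x. (norm x)\<^sup>2 / 2 - \<eta> * f x"])
  fix x y assume xy: "x \<in> \<Omega>" "y \<in> \<Omega>"
  \<comment> \<open>The Bregman divergence of half the squared norm is half the squared distance.
    Hence smoothness of \<open>f\<close> yields the lower bound and strong convexity the upper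
    one.\<close>
  have eq: "((norm x)\<^sup>2 / 2 - \<eta> * f x) - ((norm y)\<^sup>2 / 2 - \<eta> * f y) - (y - \<eta> *\<^sub>R g y) \<bullet> (x - y)
      = (norm (x - y))\<^sup>2 / 2 - \<eta> * (f x - f y - g y \<bullet> (x - y))"
    unfolding power2_norm_eq_inner
    by (simp add: inner_diff_left inner_diff_right inner_commute[of y x] field_simps)
  have "\<eta> * (f x - f y - g y \<bullet> (x - y)) \<le> \<eta> * (\<beta> / 2 * (norm (x - y))\<^sup>2)"
    using smooth_on_quadratic_upper[OF assms(2,3) xy(2,1)] assms(4)
    by (intro mult_left_mono) auto
  also have "\<dots> \<le> 1 * ((norm (x - y))\<^sup>2 / 2)"
    using mult_right_mono[OF assms(6), of "(norm (x - y))\<^sup>2 / 2"] by (simp add: mult_ac)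
  finally show "0 \<le> ((norm x)\<^sup>2 / 2 - \<eta> * f x) - ((norm y)\<^sup>2 / 2 - \<eta> * f y)
      - (y - \<eta> *\<^sub>R g y) \<bullet> (x - y)"
    unfolding eq by simp
  have "f x \<ge> f y + g y \<bullet> (x - y) + \<alpha> / 2 * (norm (x - y))\<^sup>2"
    using assms(1) xy by (auto simp: strongly_convex_on_def)
  then have "\<eta> * (\<alpha> / 2 * (norm (x - y))\<^sup>2) \<le> \<eta> * (f x - f y - g y \<bullet> (x - y))"
    using assms(4) by (intro mult_left_mono) auto
  then show "((norm x)\<^sup>2 / 2 - \<eta> * f x) - ((norm y)\<^sup>2 / 2 - \<eta> * f y) - (y - \<eta> *\<^sub>R g y) \<bullet> (x - y)
      \<le> (1 - \<eta> * \<alpha>) / 2 * (norm (x - y))\<^sup>2"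
    unfolding eq by (simp add: algebra_simps diff_divide_distrib)
next
  show "continuous_on \<Omega> (\<lambda>x. x - \<eta> *\<^sub>R g x)"
    using assms(2) by (auto simp: smooth_on_def intro!: continuous_intros dest: lipschitz_on_continuous_on)
qed (use assms in auto)

section \<open>Averaging over the sample\<close>

lemma gradient_on_emp_risk:
  fixes l :: "'a::euclidean_space \<Rightarrow> 'z \<Rightarrow> real"
  assumes "\<And>j. j < n \<Longrightarrow> gradient_on \<Omega> (\<lambda>\<theta>. l \<theta> (S j)) (G j)"
  shows "gradient_on \<Omega> (emp_risk l n S) (\<lambda>\<theta>. (\<Sum>j<n. G j \<theta>) /\<^sub>R real n)"
  unfolding gradient_on_def
proof
  fix u assume "u \<in> \<Omega>"
  then have "((\<lambda>\<theta>. (\<Sum>j<n. l \<theta> (S j)) * inverse (real n)) has_derivative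
      (\<lambda>h. (\<Sum>j<n. G j u \<bullet> h) * inverse (real n))) (at u within \<Omega>)"
    using assms by (intro has_derivative_mult_left has_derivative_sum) (auto simp: gradient_on_def)
  then show "(emp_risk l n S has_derivative
      (\<lambda>h. ((\<Sum>j<n. G j u) /\<^sub>R real n) \<bullet> h)) (at u within \<Omega>)"
    unfolding emp_risk_def[abs_def] inner_scaleR_left inner_sum_left
    by (simp add: divide_inverse mult.commute)
qed

lemma smooth_on_emp_risk:
  fixes l :: "'a::euclidean_space \<Rightarrow> 'z \<Rightarrow> real"
  assumes "n \<ge> 1" "\<And>j. j < n \<Longrightarrow> smooth_on \<beta> \<Omega> (\<lambda>\<theta>. l \<theta> (S j)) (G j)"
  shows "smooth_on \<beta> \<Omega> (emp_risk l n S) (\<lambda>\<theta>. (\<Sum>j<n. G j \<theta>) /\<^sub>R real n)"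
  unfolding smooth_on_def
proof
  have lip: "\<beta>-lipschitz_on \<Omega> (G j)" if "j < n" for j
    using assms(2) that by (auto simp: smooth_on_def)
  show "\<beta>-lipschitz_on \<Omega> (\<lambda>\<theta>. (\<Sum>j<n. G j \<theta>) /\<^sub>R real n)"
  proof (rule lipschitz_onI)
    \<comment> \<open>A nonempty sample supplies a summand whose Lipschitz property includes this
      sign.\<close>
    show "0 \<le> \<beta>" using lip[of 0] assms(1) by (auto dest: lipschitz_on_nonneg)
    fix x y assume xy: "x \<in> \<Omega>" "y \<in> \<Omega>"
    have "norm ((\<Sum>j<n. G j x) - (\<Sum>j<n. G j y)) = norm (\<Sum>j<n. G j x - G j y)"
      by (simp add: sum_subtractf)
    also have "\<dots> \<le> (\<Sum>j<n. \<beta> * dist x y)"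
      using lipschitz_onD[OF lip xy] by (intro sum_norm_le) (auto simp: dist_norm)
    also have "\<dots> = real n * (\<beta> * dist x y)" by simp
    finally have "norm ((\<Sum>j<n. G j x) - (\<Sum>j<n. G j y)) / real n \<le> \<beta> * dist x y"
      using assms(1) by (simp add: pos_divide_le_eq mult_ac)
    then show "dist ((\<Sum>j<n. G j x) /\<^sub>R real n) ((\<Sum>j<n. G j y) /\<^sub>R real n) \<le> \<beta> * dist x y"
      by (simp add: dist_norm divide_inverse mult.commute flip: scaleR_diff_right)
  qed
qed (use assms in \<open>auto intro!: gradient_on_emp_risk simp: smooth_on_def\<close>)

lemma strongly_convex_on_emp_risk:
  fixes l :: "'a::euclidean_space \<Rightarrow> 'z \<Rightarrow> real"
  assumes "n \<ge> 1" "\<And>j. j < n \<Longrightarrow> strongly_convex_on \<alpha> \<Omega> (\<lambda>\<theta>. l \<theta> (S j)) (G j)"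
  shows "strongly_convex_on \<alpha> \<Omega> (emp_risk l n S) (\<lambda>\<theta>. (\<Sum>j<n. G j \<theta>) /\<^sub>R real n)"
  unfolding strongly_convex_on_def
proof (intro conjI ballI)
  fix u v assume uv: "u \<in> \<Omega>" "v \<in> \<Omega>"
  have "(\<Sum>j<n. l v (S j) + G j v \<bullet> (u - v) + \<alpha> / 2 * (norm (u - v))\<^sup>2) \<le> (\<Sum>j<n. l u (S j))"
    using assms(2) uv by (intro sum_mono) (auto simp: strongly_convex_on_def)
  then have "(\<Sum>j<n. l v (S j)) + (\<Sum>j<n. G j v) \<bullet> (u - v) + real n * (\<alpha> / 2 * (norm (u - v))\<^sup>2)
      \<le> (\<Sum>j<n. l u (S j))"
    by (simp add: sum.distrib inner_sum_left)
  then have "((\<Sum>j<n. l v (S j)) + (\<Sum>j<n. G j v) \<bullet> (u - v) + real n * (\<alpha> / 2 * (norm (u - v))\<^sup>2))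
      / real n \<le> (\<Sum>j<n. l u (S j)) / real n"
    by (rule divide_right_mono) simp
  moreover have "((\<Sum>j<n. G j v) /\<^sub>R real n) \<bullet> (u - v) = (\<Sum>j<n. G j v) \<bullet> (u - v) / real n"
    by (simp only: inner_scaleR_left divide_inverse_commute)
  ultimately show "emp_risk l n S v + ((\<Sum>j<n. G j v) /\<^sub>R real n) \<bullet> (u - v) + \<alpha> / 2 * (norm (u - v))\<^sup>2
      \<le> emp_risk l n S u"
    using assms(1) by (simp add: emp_risk_def add_divide_distrib del: inner_scaleR_left)
qed (use assms in \<open>auto intro!: gradient_on_emp_risk simp: strongly_convex_on_def\<close>)

section \<open>Stability under exchange of one sample point\<close>

text \<open>Expanding \<open>e \<bullet> e\<close> for the difference \<open>e\<close> of the new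
  iterates leaves a contraction term for one sample plus the change of gradient at \<open>v\<close>.
  The latter is a difference of two loss gradients over \<open>n\<close>, each at most
  \<open>L\<close> along \<open>e\<close>. Since both new iterates lie in \<Omega>, \<open>e\<close>
  is an admissible test vector.\<close>

lemma gd_step_neighbouring_samples:
  fixes l :: "'a::euclidean_space \<Rightarrow> 'z \<Rightarrow> real" and gl :: "'z \<Rightarrow> 'a \<Rightarrow> 'a"
  assumes "convex \<Omega>" "0 \<le> \<eta>" "\<eta> * \<alpha> \<le> 1" "\<eta> * \<beta> \<le> 1"
    and sc: "\<And>z. z \<in> Z \<Longrightarrow> strongly_convex_on \<alpha> \<Omega> (\<lambda>\<theta>. l \<theta> z) (gl z)"
    and sm: "\<And>z. z \<in> Z \<Longrightarrow> smooth_on \<beta> \<Omega> (\<lambda>\<theta>. l \<theta> z) (gl z)"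
    and lip: "\<And>z. z \<in> Z \<Longrightarrow> L-lipschitz_on \<Omega> (\<lambda>\<theta>. l \<theta> z)"
    and k: "k < n" and S: "\<And>j. j < n \<Longrightarrow> S j \<in> Z" and S': "\<And>j. j < n \<Longrightarrow> S' j \<in> Z"
    and eq: "\<And>j. j < n \<Longrightarrow> j \<noteq> k \<Longrightarrow> S j = S' j"
    and grad: "gradient_on \<Omega> (emp_risk l n S) g" and grad': "gradient_on \<Omega> (emp_risk l n S') g'"
    and mem: "u \<in> \<Omega>" "v \<in> \<Omega>" "u - \<eta> *\<^sub>R g u \<in> \<Omega>" "v - \<eta> *\<^sub>R g' v \<in> \<Omega>"
  shows "norm ((u - \<eta> *\<^sub>R g u) - (v - \<eta> *\<^sub>R g' v)) \<le> (1 - \<eta> * \<alpha>) * norm (u - v) + 2 * L * \<eta> / n"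
proof -
  define e where "e = (u - \<eta> *\<^sub>R g u) - (v - \<eta> *\<^sub>R g' v)"
  define G where "G S \<theta> = (\<Sum>j<n. gl (S j) \<theta>) /\<^sub>R real n" for S \<theta>
  have n: "n \<ge> 1" using k by simp
  have scS: "strongly_convex_on \<alpha> \<Omega> (emp_risk l n S) (G S)"
    and smS: "smooth_on \<beta> \<Omega> (emp_risk l n S) (G S)"
    and smS': "smooth_on \<beta> \<Omega> (emp_risk l n S') (G S')"
    unfolding G_def using n sc sm S S'
    by (auto intro!: strongly_convex_on_emp_risk smooth_on_emp_risk)
  have "g u \<bullet> e = G S u \<bullet> e"
    unfolding e_def using grad smS assms(1) mem
    by (intro gradient_on_inner_unique) (auto simp: smooth_on_def)
  moreover have "g' v \<bullet> e = G S' v \<bullet> e"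
    unfolding e_def using grad' smS' assms(1) mem
    by (intro gradient_on_inner_unique) (auto simp: smooth_on_def)
  ultimately have "e \<bullet> e = ((u - \<eta> *\<^sub>R G S u) - (v - \<eta> *\<^sub>R G S v)) \<bullet> e + \<eta> * ((G S' v - G S v) \<bullet> e)"
    by (subst (1) e_def) (simp add: inner_diff_left algebra_simps)
  moreover have "((u - \<eta> *\<^sub>R G S u) - (v - \<eta> *\<^sub>R G S v)) \<bullet> e \<le> (1 - \<eta> * \<alpha>) * norm (u - v) * norm e"
    unfolding e_def
    by (rule strongly_convex_smooth_step[OF scS smS assms(1-4) mem])
  moreover have "\<eta> * ((G S' v - G S v) \<bullet> e) \<le> \<eta> * (2 * L / n * norm e)"
  proof (rule mult_left_mono[OF _ assms(2)])
    have gl_le: "gl z v \<bullet> (y - y') \<le> L * norm (y - y')" if "z \<in> Z" "y \<in> \<Omega>" "y' \<in> \<Omega>" for z y y'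
      using lip[OF that(1)] sm[OF that(1)] assms(1) mem that
      by (intro lipschitz_on_gradient_inner_le) (auto simp: smooth_on_def lipschitz_on_continuous_on)
    have "(\<Sum>j<n. gl (S' j) v - gl (S j) v) = (\<Sum>j<n. if j = k then gl (S' k) v - gl (S k) v else 0)"
      using eq by (intro sum.cong) auto
    also have "\<dots> = gl (S' k) v - gl (S k) v"
      using k by simp
    finally have "G S' v - G S v = (gl (S' k) v - gl (S k) v) /\<^sub>R real n"
      by (simp add: G_def sum_subtractf flip: scaleR_diff_right)
    moreover have "(gl (S' k) v - gl (S k) v) \<bullet> e \<le> 2 * L * norm e"
    proof -
      have "gl (S' k) v \<bullet> e \<le> L * norm e"
        using gl_le[OF S'[OF k] mem(3,4)] by (simp only: e_def)
      \<comment> \<open>Reversing the two points absorbs the minus sign in front of this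
        gradient.\<close>
      moreover have "gl (S k) v \<bullet> (- e) \<le> L * norm (- e)"
        using gl_le[OF S[OF k] mem(4,3)] by (simp only: e_def minus_diff_eq)
      ultimately show ?thesis by (simp add: inner_diff_left)
    qed
    ultimately have "(G S' v - G S v) \<bullet> e = ((gl (S' k) v - gl (S k) v) \<bullet> e) / real n"
      and "(gl (S' k) v - gl (S k) v) \<bullet> e \<le> 2 * L * norm e"
      by (simp_all only: inner_scaleR_left divide_inverse_commute)
    then show "(G S' v - G S v) \<bullet> e \<le> 2 * L / n * norm e"
      using divide_right_mono[of _ "2 * L * norm e" "real n"] by simp
  qed
  ultimately have "norm e * norm e \<le> ((1 - \<eta> * \<alpha>) * norm (u - v) + 2 * L * \<eta> / n) * norm e"
    by (simp add: algebra_simps flip: norm_eq_sqrt_inner power2_norm_eq_inner power2_eq_square)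
  \<comment> \<open>Cancelling \<open>norm e\<close> leaves out the case \<open>e = 0\<close>, which
    this sign settles.\<close>
  moreover have "0 \<le> (1 - \<eta> * \<alpha>) * norm (u - v) + 2 * L * \<eta> / n"
    using assms(2,3) lipschitz_on_nonneg[OF lip[OF S[OF k]]] by simp
  ultimately have "norm e \<le> (1 - \<eta> * \<alpha>) * norm (u - v) + 2 * L * \<eta> / n"
    by (cases "e = 0") auto
  then show ?thesis by (simp add: e_def)
qed

theorem theorem13:
  fixes \<Omega> :: "'a::euclidean_space set" and P :: "'z measure"
    and l :: "'a \<Rightarrow> 'z \<Rightarrow> real" and gl :: "'z \<Rightarrow> 'a \<Rightarrow> 'a"
    and gR :: "(nat \<Rightarrow> 'z) \<Rightarrow> 'a \<Rightarrow> 'a"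
    and \<alpha> \<beta> \<kappa> L \<eta> :: real and \<theta>\<^sub>0 :: 'a and n T :: nat
  assumes "prob_space P"
    and "convex \<Omega>"
    and "0 < \<alpha>" and "\<alpha> \<le> \<beta>" and "\<kappa> = \<beta> / \<alpha>"
    and "\<And>z. z \<in> space P \<Longrightarrow> strongly_convex_on \<alpha> \<Omega> (\<lambda>\<theta>. l \<theta> z) (gl z)"
    and "\<And>z. z \<in> space P \<Longrightarrow> smooth_on \<beta> \<Omega> (\<lambda>\<theta>. l \<theta> z) (gl z)"
    and "\<And>z. z \<in> space P \<Longrightarrow> L-lipschitz_on \<Omega> (\<lambda>\<theta>. l \<theta> z)"
    and "0 < \<eta>" and "\<eta> \<le> 1 / \<beta>"
    and "n \<ge> 1" and "T \<ge> 1"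
    and "\<theta>\<^sub>0 \<in> \<Omega>"
    and "\<And>S. S \<in> samples P n \<Longrightarrow> gradient_on \<Omega> (emp_risk l n S) (gR S)"
    and "\<And>S t. S \<in> samples P n \<Longrightarrow> gd (gR S) \<eta> \<theta>\<^sub>0 t \<in> \<Omega>"
  shows "unif_stab (\<lambda>S. gd (gR S) \<eta> \<theta>\<^sub>0 T) l P n
       \<le> ereal (4 * L\<^sup>2 / (\<alpha> * real n) * (1 - (1 - \<eta> * \<beta> / (1 + \<kappa>)) ^ T))"
proof -
  define c where "c = \<eta> * \<beta> / (1 + \<kappa>)"
  have L: "0 \<le> L"
  proof -
    obtain z where "z \<in> space P"
      using prob_space.not_empty[OF assms(1)] by blast
    then show ?thesis using assms(8) lipschitz_on_nonneg by blast
  qed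
  have \<beta>: "0 < \<beta>" using assms(3,4) by linarith
  have \<eta>\<beta>: "\<eta> * \<beta> \<le> 1"
    using assms(10) \<beta> by (simp add: field_simps)
  \<comment> \<open>\<open>c\<close> is \<eta> times half the harmonic mean of \<alpha> and \<beta>,
    hence between \<open>\<eta> * \<alpha> / 2\<close> and \<open>\<eta> * \<alpha>\<close> because
    \<alpha> \<le> \<beta>.\<close>
  have c_eq: "c = \<eta> * (\<alpha> * \<beta> / (\<alpha> + \<beta>))"
  proof -
    have "1 + \<kappa> = (\<alpha> + \<beta>) / \<alpha>"
      using assms(3,5) by (simp add: field_simps)
    then show ?thesis by (simp add: c_def mult_ac)
  qed
  have c0: "0 < c" using assms(3,9) \<beta> by (simp add: c_eq)
  have "\<alpha> * \<beta> / (\<alpha> + \<beta>) \<le> \<alpha>" "\<alpha> / 2 \<le> \<alpha> * \<beta> / (\<alpha> + \<beta>)"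
    using assms(3,4) \<beta> by (simp_all add: field_simps)
  then have c_le: "c \<le> \<eta> * \<alpha>" and c_ge: "\<eta> * (\<alpha> / 2) \<le> c"
    unfolding c_eq using assms(9) by (blast intro: mult_left_mono less_imp_le)+
  have \<eta>\<alpha>: "\<eta> * \<alpha> \<le> 1"
    using mult_left_mono[OF assms(4), of \<eta>] assms(9) \<eta>\<beta> by linarith
  have "uniformly_stable (\<lambda>S. gd (gR S) \<eta> \<theta>\<^sub>0 T) l P n
      (ereal (4 * L\<^sup>2 / (\<alpha> * real n) * (1 - (1 - c) ^ T)))"
    unfolding uniformly_stable_def
  proof (intro allI impI ballI SUP_least)
    fix k S S' z
    assume k: "k < n" and S: "S \<in> samples P n" and S': "S' \<in> samples P n"
      and eq: "\<forall>j<n. j \<noteq> k \<longrightarrow> S j = S' j" and z: "z \<in> space P"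
    have space: "S j \<in> space P" "S' j \<in> space P" if "j < n" for j
      using S S' that by (auto simp: samples_def space_PiM PiE_def Pi_def)
    let ?d = "\<lambda>t. norm (gd (gR S) \<eta> \<theta>\<^sub>0 t - gd (gR S') \<eta> \<theta>\<^sub>0 t)"
    have step: "?d (Suc t) \<le> (1 - c) * ?d t + 2 * L * \<eta> / n" for t
    proof -
      have "?d (Suc t) \<le> (1 - \<eta> * \<alpha>) * ?d t + 2 * L * \<eta> / n"
        unfolding gd.simps
      proof (rule gd_step_neighbouring_samples[OF assms(2) _ \<eta>\<alpha> \<eta>\<beta> assms(6-8) k space _
            assms(14)[OF S] assms(14)[OF S'] assms(15)[OF S] assms(15)[OF S']])
        show "gd (gR S) \<eta> \<theta>\<^sub>0 t - \<eta> *\<^sub>R gR S (gd (gR S) \<eta> \<theta>\<^sub>0 t) \<in> \<Omega>"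
          using assms(15)[OF S, of "Suc t"] by simp
        show "gd (gR S') \<eta> \<theta>\<^sub>0 t - \<eta> *\<^sub>R gR S' (gd (gR S') \<eta> \<theta>\<^sub>0 t) \<in> \<Omega>"
          using assms(15)[OF S', of "Suc t"] by simp
      qed (use assms(9) eq in auto)
      \<comment> \<open>The contraction is weakened to the rate of the stated bound.\<close>
      also have "\<dots> \<le> (1 - c) * ?d t + 2 * L * \<eta> / n"
        using c_le by (intro add_right_mono mult_right_mono) auto
      finally show ?thesis .
    qed
    \<comment> \<open>Both runs start at the same point, so the distance at time 0 vanishes and only
      the geometric sum of the perturbations remains.\<close>
    have d: "?d t \<le> 2 * L * \<eta> / n * ((1 - (1 - c) ^ t) / c)" for t
    proof (induction t)
      case (Suc t)
      have "?d (Suc t) \<le> (1 - c) * (2 * L * \<eta> / n * ((1 - (1 - c) ^ t) / c)) + 2 * L * \<eta> / n"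
        using step[of t] mult_left_mono[OF Suc, of "1 - c"] c_le \<eta>\<alpha> by linarith
      also have "\<dots> = 2 * L * \<eta> / n * ((1 - c) * ((1 - (1 - c) ^ t) / c) + 1)"
        by (simp only: distrib_left mult_1_right mult.left_commute[of "1 - c"])
      also have "(1 - c) * ((1 - (1 - c) ^ t) / c) + 1 = (1 - (1 - c) ^ Suc t) / c"
        using c0 by (simp add: divide_simps) (simp add: algebra_simps)
      finally show ?case .
    qed simp
    have "\<bar>l (gd (gR S) \<eta> \<theta>\<^sub>0 T) z - l (gd (gR S') \<eta> \<theta>\<^sub>0 T) z\<bar> \<le> L * ?d T"
      using lipschitz_onD[OF assms(8)[OF z] assms(15)[OF S] assms(15)[OF S']]
      by (simp add: dist_norm)
    also have "\<dots> \<le> L * (2 * L * \<eta> / n * ((1 - (1 - c) ^ T) / c))"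
      using d L by (rule mult_left_mono)
    also have "\<dots> = 2 * L\<^sup>2 / n * (1 - (1 - c) ^ T) * (\<eta> / c)"
      by (simp add: power2_eq_square)
    \<comment> \<open>The lower bound on \<open>c\<close> removes the step size from the prefactor;
      its factor 2 turns the constant 2 into 4.\<close>
    also have "\<dots> \<le> 2 * L\<^sup>2 / n * (1 - (1 - c) ^ T) * (2 / \<alpha>)"
    proof (rule mult_left_mono)
      show "\<eta> / c \<le> 2 / \<alpha>"
        using c_ge c0 assms(3) by (simp add: field_simps)
      have "(1 - c) ^ T \<le> 1"
        using c0 c_le \<eta>\<alpha> by (intro power_le_one) auto
      then show "0 \<le> 2 * L\<^sup>2 / n * (1 - (1 - c) ^ T)" by simp
    qed
    also have "\<dots> = 4 * L\<^sup>2 / (\<alpha> * real n) * (1 - (1 - c) ^ T)"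
      by (simp add: field_simps)
    finally show "ereal \<bar>l (gd (gR S) \<eta> \<theta>\<^sub>0 T) z - l (gd (gR S') \<eta> \<theta>\<^sub>0 T) z\<bar>
        \<le> ereal (4 * L\<^sup>2 / (\<alpha> * real n) * (1 - (1 - c) ^ T))"
      by simp
  qed
  then show ?thesis
    unfolding unif_stab_def c_def by (intro Inf_lower) simp
qed

end
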